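(* Let $A=\{\mathbf a_1,\dots,\mathbf a_N\}\subseteq\mathbb Z^n$ and suppose there is a linear form $h$ on $\mathbb R^n$ with $h(\mathbf a_i)=1$ for $i=1,\dots,N$. Let $0\le M\le N$ and let $v=(v_1,\dots,v_N)$ with $v_i=-1$ for $i=1,\dots,M$ and $v_i=0$ for $i=M+1,\dots,N$. Put $\beta=\sum_{i=1}^N v_i\mathbf a_i=-\sum_{i=1}^M\mathbf a_i\in\mathbb Z^n$. If $w_\Delta(\sigma_{-\beta}^\circ\cap\mathbb Z^n)=M$, then the series $$\Phi_v(\lambda)=\sum_{l\in L_v}\frac{[v]_{l_-}}{[v+l]_{l_+}}\lambda^{v+l}$$ has integer coefficients.
   Context: Let $L=\{l\in\mathbb Z^N:\sum_i l_i\mathbf a_i=\mathbf0\}$, ${\rm nsupp}(v)=\{i: v_i\text{ is a negative integer}\}$, $L_v=\{l\in L:{\rm nsupp}(v+l)={\rm nsupp}(v)\}$, $[v]_{l_-}=\prod_{l_i<0}\prod_{j=1}^{-l_i}(v_i-j+1)$, $[v+l]_{l_+}=\prod_{l_i>0}\prod_{j=1}^{l_i}(v_i+j)$. The coefficients of $\Phi_v(\lambda)$ are the rational numbers $[v]_{l_-}/[v+l]_{l_+}$, $l\in L_v$. Let $\Delta$ be the convex hull of $A\cup\{\mathbf0\}$ in $\mathbb R^n$ and $C(\Delta)$ the real cone generated by $\Delta$. For $\gamma\in C(\Delta)$ let $w_\Delta(\gamma)$ be the smallest real $w\ge0$ such that $\gamma\in w\Delta$; for $X\subseteq C(\Delta)$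 put $w_\Delta(X)=\inf\{w_\Delta(\gamma):\gamma\in X\}$. Let $\sigma_{-\beta}$ be the smallest closed face of $C(\Delta)$ containing $-\beta$, and $\sigma_{-\beta}^\circ$ be $\sigma_{-\beta}$ minus the union of all its proper closed faces. *)

theory Defs
  imports "HOL-Analysis.Analysis"
begin

text \<open>
  The vectors \<open>a\<^sub>1, \<dots>, a\<^sub>N\<close> are given by a function on \<open>nat\<close> of which only the values on \<open>{1..N}\<close>
  matter; integer vectors are viewed inside \<open>real ^ 'n\<close>.
\<close>

definition lattice_points :: "(real ^ 'n) set" where
  "lattice_points = {x. \<forall>k. x $ k \<in> \<int>}"

text \<open>\<open>\<int>\<^sup>N\<close> is represented by the integer sequences vanishing outside \<open>{1..N}\<close>.\<close>

definition relation_lattice :: "nat \<Rightarrow> (nat \<Rightarrow> real ^ 'n) \<Rightarrow> (nat \<Rightarrow> int) set" where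
  "relation_lattice N a =
    {l. (\<forall>i. i \<notin> {1..N} \<longrightarrow> l i = 0) \<and> (\<Sum>i=1..N. of_int (l i) *\<^sub>R a i) = 0}"

definition nsupp :: "nat \<Rightarrow> (nat \<Rightarrow> rat) \<Rightarrow> nat set" where
  "nsupp N v = {i \<in> {1..N}. v i \<in> \<int> \<and> v i < 0}"

definition shift :: "(nat \<Rightarrow> rat) \<Rightarrow> (nat \<Rightarrow> int) \<Rightarrow> nat \<Rightarrow> rat" where
  "shift v l = (\<lambda>i. v i + of_int (l i))"

definition L_of :: "nat \<Rightarrow> (nat \<Rightarrow> real ^ 'n) \<Rightarrow> (nat \<Rightarrow> rat) \<Rightarrow> (nat \<Rightarrow> int) set" where
  "L_of N a v = {l \<in> relation_lattice N a. nsupp N (shift v l) = nsupp N v}"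

text \<open>\<open>bracket_minus N v l\<close> is \<open>[v]\<close> with index \<open>l\<^sub>-\<close>.\<close>

definition bracket_minus :: "nat \<Rightarrow> (nat \<Rightarrow> rat) \<Rightarrow> (nat \<Rightarrow> int) \<Rightarrow> rat" where
  "bracket_minus N v l =
    (\<Prod>i \<in> {i \<in> {1..N}. l i < 0}. \<Prod>j = 1..nat (- l i). v i - of_nat j + 1)"

text \<open>\<open>bracket_plus N v l\<close> is \<open>[v + l]\<close> with index \<open>l\<^sub>+\<close>: the argument is \<open>v\<close>, not \<open>v + l\<close>.\<close>

definition bracket_plus :: "nat \<Rightarrow> (nat \<Rightarrow> rat) \<Rightarrow> (nat \<Rightarrow> int) \<Rightarrow> rat" where
  "bracket_plus N v l =
    (\<Prod>i \<in> {i \<in> {1..N}. 0 < l i}. \<Prod>j = 1..nat (l i). v i + of_nat j)"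

text \<open>
  A formal series in \<open>\<lambda>\<^sub>1, \<dots>, \<lambda>\<^sub>N\<close> with rational exponents is the function sending an exponent vector
  \<open>u\<close> to the coefficient of \<open>\<lambda>\<^sup>u\<close>. At most one \<open>l\<close> contributes to each \<open>u\<close>.
\<close>

definition Phi :: "nat \<Rightarrow> (nat \<Rightarrow> real ^ 'n) \<Rightarrow> (nat \<Rightarrow> rat) \<Rightarrow> (nat \<Rightarrow> rat) \<Rightarrow> rat" where
  "Phi N a v u =
    (\<Sum>l \<in> {l \<in> L_of N a v. shift v l = u}. bracket_minus N v l / bracket_plus N v l)"

lemma Phi_shift:
  assumes "l \<in> L_of N a v"
  shows "Phi N a v (shift v l) = bracket_minus N v l / bracket_plus N v l"
proof -
  have "{l' \<in> L_of N a v. shift v l' = shift v l} = {l}"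
    using assms by (auto simp: shift_def fun_eq_iff)
  then show ?thesis
    by (simp add: Phi_def)
qed

definition Delta :: "nat \<Rightarrow> (nat \<Rightarrow> real ^ 'n) \<Rightarrow> (real ^ 'n) set" where
  "Delta N a = convex hull (insert 0 (a ` {1..N}))"

definition weight :: "(real ^ 'n) set \<Rightarrow> real ^ 'n \<Rightarrow> real" where
  "weight D x = (LEAST w. 0 \<le> w \<and> x \<in> (\<lambda>y. w *\<^sub>R y) ` D)"

text \<open>Used only for nonempty \<open>X\<close>, where the real-valued \<open>Inf\<close> is the usual infimum.\<close>

definition weight_set :: "(real ^ 'n) set \<Rightarrow> (real ^ 'n) set \<Rightarrow> real" where
  "weight_set D X = (INF x\<in>X. weight D x)"

text \<open>An intersection of closed faces is again a closed face, so this is the smallest one.\<close>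

definition smallest_face :: "(real ^ 'n) set \<Rightarrow> real ^ 'n \<Rightarrow> (real ^ 'n) set" where
  "smallest_face C x = \<Inter> {F. F face_of C \<and> closed F \<and> x \<in> F}"

definition face_interior :: "(real ^ 'n) set \<Rightarrow> (real ^ 'n) set" where
  "face_interior S = S - \<Union> {F. F face_of S \<and> closed F \<and> F \<noteq> S}"

end

theory Submission
  imports Defs "HOL-Computational_Algebra.Primes"
begin

text \<open>
  For \<open>l \<in> L\<^sub>v\<close> put \<open>k\<^sub>i = -l\<^sub>i\<close>; the coefficient is, up to sign,
  \<open>\<Prod>\<^sub>i\<^sub>\<le>\<^sub>M k\<^sub>i! / \<Prod>\<^sub>i\<^sub>>\<^sub>M l\<^sub>i!\<close>. By Legendre's formula it is an integer as soon as
  \<open>\<Sum>\<^sub>i\<^sub>>\<^sub>M \<lfloor>l\<^sub>i/q\<rfloor> \<le> \<Sum>\<^sub>i\<^sub>\<le>\<^sub>M \<lfloor>k\<^sub>i/q\<rfloor>\<close> for every \<open>q\<close>. The point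
  \<open>\<gamma> = \<Sum>\<^sub>i\<^sub>\<le>\<^sub>M (1 + \<lfloor>k\<^sub>i/q\<rfloor>) a\<^sub>i - \<Sum>\<^sub>i\<^sub>>\<^sub>M \<lfloor>l\<^sub>i/q\<rfloor> a\<^sub>i\<close> is a lattice point, and since \<open>l\<close> is a relation
  it is also \<open>\<Sum>\<^sub>i\<^sub>\<le>\<^sub>M (1 - {k\<^sub>i/q}) a\<^sub>i + \<Sum>\<^sub>i\<^sub>>\<^sub>M {l\<^sub>i/q} a\<^sub>i\<close>, a combination of vectors of the face
  \<open>\<sigma>\<close> of \<open>-\<beta>\<close> whose coefficients for \<open>i \<le> M\<close> are positive. So it lies in the interior of \<open>\<sigma>\<close>, and
  its weight \<open>h \<gamma> = M + \<Sum> \<lfloor>k\<^sub>i/q\<rfloor> - \<Sum> \<lfloor>l\<^sub>i/q\<rfloor>\<close> is at least \<open>M\<close>.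
\<close>

section \<open>Legendre's formula and divisibility between products of factorials\<close>

text \<open>Passing from \<open>n\<close> to \<open>Suc n\<close> raises the \<open>r\<close>-th
  quotient by one exactly when \<open>p ^ r\<close> divides \<open>Suc n\<close>. Leaving the
  truncation \<open>R\<close> free lets several factorials share one bound.\<close>

lemma multiplicity_fact_nat:
  fixes p n R :: nat
  assumes p: "prime p" and "n \<le> R"
  shows "multiplicity p (fact n) = (\<Sum>r=1..R. n div p ^ r)"
  using \<open>n \<le> R\<close>
proof (induction n)
  case 0
  then show ?case by simp
next
  case (Suc n)
  have p2: "p \<ge> 2" using p by (rule prime_ge_2_nat)
  let ?m = "multiplicity p (Suc n)"
  have "?m < 2 ^ ?m" by (rule less_exp)
  also have "\<dots> \<le> p ^ ?m" using p2 by (simp add: power_mono)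
  also have "\<dots> \<le> Suc n" by (intro dvd_imp_le multiplicity_dvd) simp
  finally have "?m \<le> R" using Suc.prems by simp
  have dvd: "p ^ r dvd Suc n \<longleftrightarrow> r \<le> ?m" for r
    using p2 by (intro power_dvd_iff_le_multiplicity) auto
  have "(\<Sum>r=1..R. Suc n div p ^ r) = (\<Sum>r=1..R. n div p ^ r + (if r \<le> ?m then 1 else 0))"
    by (intro sum.cong refl) (auto simp: div_Suc simp flip: dvd mod_eq_0_iff_dvd)
  also have "\<dots> = (\<Sum>r=1..R. n div p ^ r) + card {r \<in> {1..R}. r \<le> ?m}"
    by (simp add: sum.distrib sum.If_cases Int_def del: One_nat_def)
  also have "{r \<in> {1..R}. r \<le> ?m} = {1..?m}" using \<open>?m \<le> R\<close> by auto
  also have "(\<Sum>r=1..R. n div p ^ r) + card {1..?m} = multiplicity p (fact n) + ?m"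
    using Suc by simp
  also have "\<dots> = multiplicity p (fact (Suc n))"
    using p by (subst fact_Suc, subst prime_elem_multiplicity_mult_distrib) auto
  finally show ?case by simp
qed

text \<open>Multiplicities are compared prime by prime: Legendre's formula turns both sides into
  sums over the powers \<open>q = p ^ r\<close>, and \<open>le\<close> applies to each
  power.\<close>

lemma prod_fact_dvd_prod_fact:
  fixes k m :: "'i \<Rightarrow> nat"
  assumes fin: "finite A" "finite B"
    and le: "\<And>q. q > 0 \<Longrightarrow> (\<Sum>i\<in>B. m i div q) \<le> (\<Sum>i\<in>A. k i div q)"
  shows "(\<Prod>i\<in>B. fact (m i)) dvd (\<Prod>i\<in>A. fact (k i) :: nat)"
proof (rule multiplicity_le_imp_dvd)
  show "(\<Prod>i\<in>B. fact (m i)) \<noteq> (0::nat)" using fin by simp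
next
  fix p :: nat
  assume p: "prime p"
  \<comment> \<open>A common truncation for all the factorials; inserting 0 keeps \<open>Max\<close>
    meaningful when both index sets are empty.\<close>
  define R where "R = Max (insert 0 (k ` A \<union> m ` B))"
  have R: "k i \<le> R" if "i \<in> A" for i using that fin by (auto simp: R_def)
  have R': "m i \<le> R" if "i \<in> B" for i using that fin by (auto simp: R_def)
  have "multiplicity p (\<Prod>i\<in>B. fact (m i)) = (\<Sum>i\<in>B. \<Sum>r=1..R. m i div p ^ r)"
    using p fin by (subst prime_elem_multiplicity_prod_distrib)
      (auto intro!: sum.cong multiplicity_fact_nat R' simp del: One_nat_def)
  also have "\<dots> = (\<Sum>r=1..R. \<Sum>i\<in>B. m i div p ^ r)" by (rule sum.swap)
  also have "\<dots> \<le> (\<Sum>r=1..R. \<Sum>i\<in>A. k i div p ^ r)"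
    using p by (intro sum_mono le) (simp add: prime_gt_0_nat)
  also have "\<dots> = (\<Sum>i\<in>A. \<Sum>r=1..R. k i div p ^ r)" by (rule sum.swap)
  also have "\<dots> = multiplicity p (\<Prod>i\<in>A. fact (k i))"
    using p fin by (subst prime_elem_multiplicity_prod_distrib)
      (auto intro!: sum.cong multiplicity_fact_nat[symmetric] R simp del: One_nat_def)
  finally show "multiplicity p (\<Prod>i\<in>B. fact (m i)) \<le> multiplicity p (\<Prod>i\<in>A. fact (k i) :: nat)" .
qed

section \<open>Faces of convex cones\<close>

lemma convex_cone_sum:
  assumes "convex_cone S" "\<And>i. i \<in> I \<Longrightarrow> f i \<in> S"
  shows "sum f I \<in> S"
  using assms(2)
  by (induction I rule: infinite_finite_induct)
    (auto intro: convex_cone_add[OF assms(1)] convex_cone_contains_0[OF assms(1)])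

text \<open>The sum \<open>x + y\<close> is the midpoint of \<open>x\<close> and
  \<open>x + 2 *\<^sub>R y\<close>, which both lie in the cone.\<close>

lemma face_of_convex_cone_add_left:
  assumes C: "convex_cone C" and F: "F face_of C" and "x \<in> C" "y \<in> C" "x + y \<in> F"
  shows "x \<in> F"
proof (cases "y = 0")
  case False
  have "x + 2 *\<^sub>R y \<in> C" using assms by (intro convex_cone_add convex_cone_scaleR) auto
  moreover have "x + y \<in> open_segment x (x + 2 *\<^sub>R y)"
    using False by (auto simp: in_segment algebra_simps intro!: exI[of _ "1/2"])
  ultimately show ?thesis using face_ofD[OF F _ \<open>x \<in> C\<close> _ \<open>x + y \<in> F\<close>] by blast
qed (use assms in simp)

text \<open>For \<open>c \<le> 1\<close> the multiple is a summand of \<open>x\<close>; for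
  \<open>c > 1\<close> and \<open>x \<noteq> 0\<close>, \<open>x\<close> lies strictly between 0 and
  the multiple.\<close>

lemma face_of_convex_cone_scaleR:
  assumes C: "convex_cone C" and F: "F face_of C" and x: "x \<in> F" and "0 \<le> c"
  shows "c *\<^sub>R x \<in> F"
proof -
  have xC: "x \<in> C" using x face_of_imp_subset[OF F] by blast
  have le1: "t *\<^sub>R x \<in> F" if "0 \<le> t" "t \<le> 1" for t
    using that x by (intro face_of_convex_cone_add_left[OF C F, of "t *\<^sub>R x" "(1 - t) *\<^sub>R x"]
        convex_cone_scaleR[OF C] xC) (auto simp flip: scaleR_add_left)
  show ?thesis
  proof (cases "c \<le> 1 \<or> x = 0")
    case True
    then show ?thesis using le1 \<open>0 \<le> c\<close> x by auto
  next
    case False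
    then have "x \<in> open_segment 0 (c *\<^sub>R x)"
      by (auto simp: in_segment intro!: exI[of _ "1/c"])
    then show ?thesis
      using face_ofD[OF F _ convex_cone_contains_0[OF C] convex_cone_scaleR[OF C \<open>0 \<le> c\<close> xC] x]
      by blast
  qed
qed

lemma convex_cone_face_of:
  assumes C: "convex_cone C" and F: "F face_of C" and "F \<noteq> {}"
  shows "convex_cone F"
proof -
  have "x + y \<in> F" if "x \<in> F" "y \<in> F" for x y
  proof -
    have "(1/2) *\<^sub>R x + (1/2) *\<^sub>R y \<in> F"
      using that face_of_imp_convex[OF F] by (intro convexD) auto
    from face_of_convex_cone_scaleR[OF C F this, of 2] show ?thesis
      by (simp add: scaleR_add_right)
  qed
  then show ?thesis
    using face_of_convex_cone_scaleR[OF C F] \<open>F \<noteq> {}\<close>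
    unfolding convex_cone_iff by (metis ex_in_conv scale_zero_left order_refl)
qed

text \<open>Being closed, \<open>C\<close> is itself one of the intersected faces, so the family is
  nonempty.\<close>

lemma smallest_face_face_of:
  assumes "closed C" "convex C" "x \<in> C"
  shows "smallest_face C x face_of C"
  unfolding smallest_face_def using assms face_of_refl[of C] by (intro face_of_Inter) auto

lemma mem_smallest_face: "x \<in> smallest_face C x"
  unfolding smallest_face_def by blast

text \<open>A closed face of the smallest face that contains the sum contains its summand
  \<open>t *\<^sub>R x\<close>, hence \<open>x\<close>. It is also a face of \<open>C\<close>, so
  minimality makes it the whole smallest face.\<close>

lemma mem_face_interior_smallest_face:
  assumes C: "convex_cone C" "closed C" and x: "x \<in> C"
    and y: "y \<in> smallest_face C x" and t: "t > 0"
  shows "t *\<^sub>R x + y \<in> face_interior (smallest_face C x)"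
proof -
  let ?S = "smallest_face C x"
  have S: "?S face_of C"
    using C x by (intro smallest_face_face_of) (auto simp: convex_cone_def)
  have cS: "convex_cone ?S"
    using C(1) S mem_smallest_face by (rule convex_cone_face_of[OF _ _ ex_in_conv[THEN iffD1, OF exI]])
  have tx: "t *\<^sub>R x \<in> ?S"
    using t by (intro convex_cone_scaleR[OF cS] mem_smallest_face) simp
  have "F = ?S" if F: "F face_of ?S" "closed F" "t *\<^sub>R x + y \<in> F" for F
  proof
    show "F \<subseteq> ?S" using F(1) by (rule face_of_imp_subset)
    have "t *\<^sub>R x \<in> F" by (rule face_of_convex_cone_add_left[OF cS F(1) tx y F(3)])
    from face_of_convex_cone_scaleR[OF cS F(1) this, of "1/t"] have "x \<in> F" using t by simp
    with F face_of_trans[OF F(1) S] show "?S \<subseteq> F" unfolding smallest_face_def by blast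
  qed
  then show ?thesis
    unfolding face_interior_def using convex_cone_add[OF cS tx y] by blast
qed

section \<open>The cone over \<open>Delta\<close> and its weight function\<close>

text \<open>Exhibits the cone as finitely generated, which yields convexity and, through
  polyhedrality, closedness.\<close>

lemma cone_hull_Delta: "cone hull (Delta N a) = convex_cone hull (insert 0 (a ` {1..N}))"
  unfolding Delta_def cone_hull_expl
  by (subst convex_cone_hull_convex_hull_nonempty) auto

lemma convex_cone_cone_hull_Delta: "convex_cone (cone hull (Delta N a))"
  unfolding cone_hull_Delta by (rule convex_cone_convex_cone_hull)

lemma closed_cone_hull_Delta: "closed (cone hull (Delta N a))"
  unfolding cone_hull_Delta by (intro polyhedron_imp_closed polyhedron_convex_cone_hull) simp

lemma generator_in_cone_hull_Delta: "i \<in> {1..N} \<Longrightarrow> a i \<in> cone hull (Delta N a)"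
  unfolding cone_hull_Delta by (intro hull_inc) auto

lemma
  assumes h: "linear h" "\<forall>i\<in>{1..N}. h (a i) = 1" and x: "x \<in> cone hull (Delta N a)"
  shows weight_Delta_eq: "weight (Delta N a) x = h x"
    and linear_nonneg_on_cone: "0 \<le> h x"
proof -
  interpret h: linear h by fact
  \<comment> \<open>If there are generators, \<open>z\<close> is a point of their convex hull, where
    \<open>h\<close> equals 1, on the ray through \<open>y\<close>; otherwise \<open>Delta\<close>
    is just the origin.\<close>
  have D: "\<exists>z\<in>Delta N a. y = h y *\<^sub>R z \<and> 0 \<le> h y \<and> h y \<le> 1" if y: "y \<in> Delta N a" for y
  proof (cases "a ` {1..N} = {}")
    case True
    then show ?thesis using y by (auto simp: Delta_def h.zero)
  next
    case False
    then obtain u s b where ub: "0 \<le> u" "0 \<le> s" "u + s = 1"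
        "b \<in> convex hull (a ` {1..N})" "y = u *\<^sub>R 0 + s *\<^sub>R b"
      using y unfolding Delta_def convex_hull_insert[OF False] by blast
    have "convex hull (a ` {1..N}) \<subseteq> {z. h z = 1}"
    proof (rule hull_minimal)
      show "convex {z. h z = 1}"
        by (auto simp: convex_def h.add h.scale)
    qed (use h in auto)
    then have "h y = s" using ub by (auto simp: h.add h.scale)
    moreover have "b \<in> Delta N a"
      using ub(4) hull_mono[of "a ` {1..N}" "insert 0 (a ` {1..N})" convex]
      unfolding Delta_def by blast
    ultimately show ?thesis using ub by auto
  qed
  obtain c y where cy: "c \<ge> 0" "y \<in> Delta N a" "x = c *\<^sub>R y"
    using x unfolding cone_hull_expl by blast
  obtain z where z: "z \<in> Delta N a" "y = h y *\<^sub>R z" "0 \<le> h y"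
    using D[OF cy(2)] by blast
  have hx: "h x = c * h y" using cy by (simp add: h.scale)
  then show nn: "0 \<le> h x" using cy z by simp
  have xz: "x = h x *\<^sub>R z" using z(2) cy(3) hx by (metis scaleR_scaleR)
  show "weight (Delta N a) x = h x"
    unfolding weight_def
  proof (rule Least_equality)
    show "0 \<le> h x \<and> x \<in> (\<lambda>y. h x *\<^sub>R y) ` Delta N a" using nn xz z(1) by blast
  next
    fix w assume "0 \<le> w \<and> x \<in> (\<lambda>y. w *\<^sub>R y) ` Delta N a"
    then obtain y' where y': "0 \<le> w" "y' \<in> Delta N a" "x = w *\<^sub>R y'" by blast
    then show "h x \<le> w" using D[OF y'(2)] mult_left_mono[of "h y'" 1 w] by (auto simp: h.scale)
  qed
qed

lemma weight_set_le_linear: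
  assumes h: "linear h" "\<forall>i\<in>{1..N}. h (a i) = 1"
    and X: "X \<subseteq> cone hull (Delta N a)" and x: "x \<in> X"
  shows "weight_set (Delta N a) X \<le> h x"
proof -
  have "weight_set (Delta N a) X \<le> weight (Delta N a) x"
    unfolding weight_set_def
  proof (rule cINF_lower)
    \<comment> \<open>The real-valued infimum is a lower bound only for sets bounded below; here 0
      is a bound.\<close>
    show "bdd_below (weight (Delta N a) ` X)"
    proof (rule bdd_belowI2)
      fix y assume "y \<in> X"
      then have "y \<in> cone hull (Delta N a)" using X by blast
      then show "0 \<le> weight (Delta N a) y"
        using weight_Delta_eq[OF h] linear_nonneg_on_cone[OF h] by simp
    qed
  qed fact
  also have "\<dots> = h x" using X x by (intro weight_Delta_eq[OF h]) blast
  finally show ?thesis .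
qed

section \<open>The floor inequality from the weight hypothesis\<close>

lemma lattice_points_sum_of_int:
  assumes "\<And>i. i \<in> I \<Longrightarrow> a i \<in> lattice_points"
  shows "(\<Sum>i\<in>I. of_int (z i) *\<^sub>R a i) \<in> lattice_points"
  using assms unfolding lattice_points_def by (auto intro!: Ints_sum Ints_mult)

lemma floor_sum_le:
  fixes a :: "nat \<Rightarrow> real ^ 'n" and l :: "nat \<Rightarrow> int" and M q :: nat
    and h :: "real ^ 'n \<Rightarrow> real"
  defines "b \<equiv> \<Sum>i=1..M. a i"
  assumes lat: "a ` {1..N} \<subseteq> lattice_points"
    and h: "linear h" "\<forall>i\<in>{1..N}. h (a i) = 1"
    and MN: "M \<le> N"
    and w: "real M \<le> weight_set (Delta N a)
              (face_interior (smallest_face (cone hull (Delta N a)) b) \<inter> lattice_points)"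
    and rel: "(\<Sum>i=1..N. of_int (l i) *\<^sub>R a i) = 0"
    and neg: "\<And>i. i \<in> {1..M} \<Longrightarrow> l i \<le> 0"
    and pos: "\<And>i. i \<in> {M+1..N} \<Longrightarrow> 0 \<le> l i"
    and q: "q > 0"
  shows "(\<Sum>i=M+1..N. nat (l i) div q) \<le> (\<Sum>i=1..M. nat (- l i) div q)"
proof -
  interpret h: linear h by fact
  let ?C = "cone hull (Delta N a)"
  let ?S = "smallest_face ?C b"
  note C = convex_cone_cone_hull_Delta[of N a] closed_cone_hull_Delta[of N a]
  have split: "(\<Sum>i=1..N. f i) = (\<Sum>i=1..M. f i) + (\<Sum>i=M+1..N. f i)"
    for f :: "nat \<Rightarrow> 'b::comm_monoid_add"
    using MN sum.ub_add_nat[of 1 M f "N - M"] by simp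
  have aC: "a i \<in> ?C" if "i \<in> {1..N}" for i using that by (rule generator_in_cone_hull_Delta)
  have bC: "b \<in> ?C" unfolding b_def using MN aC by (intro convex_cone_sum[OF C(1)]) auto
  have S: "?S face_of ?C" using C bC by (intro smallest_face_face_of) (auto simp: convex_cone_def)
  have cS: "convex_cone ?S"
    using convex_cone_face_of[OF C(1) S] mem_smallest_face by blast
  have summand: "f i \<in> ?S"
    if "finite I" "i \<in> I" "\<And>j. j \<in> I \<Longrightarrow> f j \<in> ?C" "sum f I \<in> ?S" for f and I :: "nat set" and i
  proof (rule face_of_convex_cone_add_left[OF C(1) S])
    show "f i \<in> ?C" using that by blast
    show "sum f (I - {i}) \<in> ?C" using that by (intro convex_cone_sum[OF C(1)]) auto
    show "f i + sum f (I - {i}) \<in> ?S" using that sum.remove[of I i f] by simp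
  qed
  have low: "a i \<in> ?S" if "i \<in> {1..M}" for i
    using that MN aC
    by (intro summand[of "{1..M}" i a]) (auto simp: mem_smallest_face simp flip: b_def simp del: One_nat_def)
  \<comment> \<open>The relation moves the terms beyond \<open>M\<close> to a nonnegative
    combination of vectors of the face, so each of these terms lies in the face. Nothing follows for
    \<open>a i\<close> with \<open>l i = 0\<close>, but there \<open>e i\<close> vanishes.\<close>
  have "(\<Sum>i=M+1..N. of_int (l i) *\<^sub>R a i) = (\<Sum>i=1..M. of_int (- l i) *\<^sub>R a i)"
    using rel unfolding split by (simp add: sum_negf add_eq_0_iff2)
  also have "\<dots> \<in> ?S"
    using low neg by (intro convex_cone_sum[OF cS] convex_cone_scaleR[OF cS]) auto
  finally have "of_int (l i) *\<^sub>R a i \<in> ?S" if "i \<in> {M+1..N}" for i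
    using that aC pos by (intro summand[of "{M+1..N}" i "\<lambda>i. of_int (l i) *\<^sub>R a i"]
        convex_cone_scaleR[OF C(1)]) auto
  then have high: "a i \<in> ?S" if "i \<in> {M+1..N}" "l i \<noteq> 0" for i
    using that pos[of i] convex_cone_scaleR[OF cS, of "1 / of_int (l i)" "of_int (l i) *\<^sub>R a i"]
    by auto
  \<comment> \<open>For \<open>i \<le> M\<close> this is \<open>1 + \<lfloor>k\<^sub>i/q\<rfloor>\<close> with \<open>k\<^sub>i = -l\<^sub>i\<close>, otherwise \<open>-\<lfloor>l\<^sub>i/q\<rfloor>\<close>.\<close>
  define z :: "nat \<Rightarrow> int" where
    "z i = (if i \<le> M then 1 + (- l i) div int q else - (l i div int q))" for i
  define g where "g = (\<Sum>i=1..N. of_int (z i) *\<^sub>R a i)"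
  \<comment> \<open>Adding \<open>1 / real q\<close> times the relation leaves \<open>g\<close>
    unchanged and turns the integer coefficients \<open>z\<close> into fractional parts, or 1 minus
    them for \<open>i \<le> M\<close>.\<close>
  define e where "e i = of_int (z i) + of_int (l i) / real q" for i
  \<comment> \<open>A remainder modulo \<open>q\<close> is at most \<open>q - 1\<close>. This
    uniform bound is what lets a positive multiple of \<open>b\<close> be split off from
    \<open>g\<close> below.\<close>
  have e_low: "1 / real q \<le> e i" if "i \<le> M" for i
  proof -
    have "of_int ((- l i) mod int q) \<le> (real q - 1)"
      using q pos_mod_bound[of "int q" "- l i"] by linarith
    moreover have "of_int ((- l i) mod int q) = of_int (- l i) - real q * of_int ((- l i) div int q)"
      by (metis minus_mult_div_eq_mod of_int_diff of_int_mult of_int_of_nat_eq)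
    ultimately show ?thesis using q that by (simp add: e_def z_def field_simps)
  qed
  have e_high: "0 \<le> e i" if "\<not> i \<le> M" for i
  proof -
    have "of_int (l i mod int q) \<ge> (0::real)" using q by simp
    moreover have "of_int (l i mod int q) = of_int (l i) - real q * of_int (l i div int q)"
      by (metis minus_mult_div_eq_mod of_int_diff of_int_mult of_int_of_nat_eq)
    ultimately show ?thesis using q that by (simp add: e_def z_def field_simps)
  qed
  have "(\<Sum>i=1..N. e i *\<^sub>R a i)
      = g + (1 / real q) *\<^sub>R (\<Sum>i=1..N. of_int (l i) *\<^sub>R a i)"
    unfolding g_def e_def by (simp add: scaleR_add_left sum.distrib scaleR_sum_right)
  then have "g = (\<Sum>i=1..N. e i *\<^sub>R a i)" using rel by simp
  also have "\<dots> = (1 / real q) *\<^sub>R b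
      + ((\<Sum>i=1..M. (e i - 1 / real q) *\<^sub>R a i) + (\<Sum>i=M+1..N. e i *\<^sub>R a i))"
    unfolding split b_def by (simp add: scaleR_diff_left sum_subtractf scaleR_sum_right)
  also have "\<dots> \<in> face_interior ?S"
  proof (rule mem_face_interior_smallest_face[OF C bC])
    have "e i *\<^sub>R a i \<in> ?S" if "i \<in> {M+1..N}" for i
    proof (cases "l i = 0")
      case True
      then have "e i = 0" using that by (simp add: e_def z_def)
      then show ?thesis using convex_cone_contains_0[OF cS] by simp
    next
      case False
      then show ?thesis using that high e_high by (intro convex_cone_scaleR[OF cS]) auto
    qed
    moreover have "(e i - 1 / real q) *\<^sub>R a i \<in> ?S" if "i \<in> {1..M}" for i
      using that low e_low by (intro convex_cone_scaleR[OF cS]) auto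
    ultimately show "(\<Sum>i=1..M. (e i - 1 / real q) *\<^sub>R a i) + (\<Sum>i=M+1..N. e i *\<^sub>R a i) \<in> ?S"
      by (intro convex_cone_add[OF cS] convex_cone_sum[OF cS]) blast+
  qed (use q in simp)
  finally have "g \<in> face_interior ?S \<inter> lattice_points"
    using lat unfolding g_def by (auto intro!: lattice_points_sum_of_int)
  moreover have "face_interior ?S \<inter> lattice_points \<subseteq> ?C"
    using face_of_imp_subset[OF S] unfolding face_interior_def by blast
  ultimately have "real M \<le> h g" using weight_set_le_linear[OF h] w by (meson order_trans)
  also have "h g = of_int (\<Sum>i=1..N. z i)"
    unfolding g_def using h(2) by (simp add: h.sum h.scale)
  finally have "int M \<le> (\<Sum>i=1..N. z i)" by linarith
  also have "\<dots> = int M + (\<Sum>i=1..M. (- l i) div int q) - (\<Sum>i=M+1..N. l i div int q)"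
    unfolding split by (simp add: z_def sum.distrib sum_negf)
  finally have "(\<Sum>i=M+1..N. l i div int q) \<le> (\<Sum>i=1..M. (- l i) div int q)" by simp
  moreover have "(\<Sum>i=M+1..N. l i div int q) = int (\<Sum>i=M+1..N. nat (l i) div q)"
    unfolding of_nat_sum using pos by (intro sum.cong) (auto simp: zdiv_int)
  moreover have "(\<Sum>i=1..M. (- l i) div int q) = int (\<Sum>i=1..M. nat (- l i) div q)"
    unfolding of_nat_sum using neg by (intro sum.cong) (auto simp: zdiv_int)
  ultimately show ?thesis by linarith
qed

section \<open>The brackets as signed products of factorials\<close>

lemma bracket_minus_eq:
  assumes "M \<le> N" and v: "\<forall>i\<in>{1..M}. v i = - 1"
    and neg: "\<And>i. i \<in> {1..M} \<Longrightarrow> l i \<le> 0" and pos: "\<And>i. i \<in> {M+1..N} \<Longrightarrow> 0 \<le> l i"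
  shows "bracket_minus N v l
    = (\<Prod>i=1..M. (- 1) ^ nat (- l i)) * of_nat (\<Prod>i=1..M. fact (nat (- l i)))"
proof -
  have "bracket_minus N v l = (\<Prod>i=1..M. \<Prod>j=1..nat (- l i). v i - of_nat j + 1)"
    unfolding bracket_minus_def
  \<comment> \<open>Indices with \<open>l i = 0\<close> contribute empty products, so all of
    \<open>{1..M}\<close> may be used.\<close>
  proof (rule prod.mono_neutral_left)
    show "{i \<in> {1..N}. l i < 0} \<subseteq> {1..M}"
    proof
      fix i assume i: "i \<in> {i \<in> {1..N}. l i < 0}"
      then show "i \<in> {1..M}" using pos[of i] by (cases "i \<le> M") auto
    qed
    show "\<forall>i\<in>{1..M} - {i \<in> {1..N}. l i < 0}. (\<Prod>j=1..nat (- l i). v i - of_nat j + 1) = 1"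
    proof
      fix i assume "i \<in> {1..M} - {i \<in> {1..N}. l i < 0}"
      then have "nat (- l i) = 0" using \<open>M \<le> N\<close> by auto
      then show "(\<Prod>j=1..nat (- l i). v i - of_nat j + 1) = 1" by simp
    qed
  qed simp
  also have "\<dots> = (\<Prod>i=1..M. (- 1) ^ nat (- l i) * of_nat (fact (nat (- l i))))"
  proof (intro prod.cong refl)
    fix i assume "i \<in> {1..M}"
    then have "(\<Prod>j=1..nat (- l i). v i - of_nat j + 1) = (\<Prod>j=1..nat (- l i). - 1 * rat_of_nat j)"
      using v by (intro prod.cong) auto
    then show "(\<Prod>j=1..nat (- l i). v i - of_nat j + 1)
        = (- 1) ^ nat (- l i) * of_nat (fact (nat (- l i)))"
      by (simp only: prod.distrib prod_constant fact_prod of_nat_prod of_nat_id) simp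
  qed
  finally show ?thesis by (simp only: prod.distrib of_nat_prod)
qed

lemma bracket_plus_eq:
  assumes v: "\<forall>i\<in>{M+1..N}. v i = 0"
    and neg: "\<And>i. i \<in> {1..M} \<Longrightarrow> l i \<le> 0" and pos: "\<And>i. i \<in> {M+1..N} \<Longrightarrow> 0 \<le> l i"
  shows "bracket_plus N v l = of_nat (\<Prod>i=M+1..N. fact (nat (l i)))"
proof -
  have "bracket_plus N v l = (\<Prod>i=M+1..N. \<Prod>j=1..nat (l i). v i + of_nat j)"
    unfolding bracket_plus_def
  proof (rule prod.mono_neutral_left)
    show "{i \<in> {1..N}. 0 < l i} \<subseteq> {M+1..N}"
    proof
      fix i assume i: "i \<in> {i \<in> {1..N}. 0 < l i}"
      then show "i \<in> {M+1..N}" using neg[of i] by (cases "i \<le> M") auto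
    qed
    show "\<forall>i\<in>{M+1..N} - {i \<in> {1..N}. 0 < l i}. (\<Prod>j=1..nat (l i). v i + of_nat j) = 1"
    proof
      fix i assume "i \<in> {M+1..N} - {i \<in> {1..N}. 0 < l i}"
      then have "nat (l i) = 0" by auto
      then show "(\<Prod>j=1..nat (l i). v i + of_nat j) = 1" by simp
    qed
  qed simp
  also have "\<dots> = (\<Prod>i=M+1..N. of_nat (fact (nat (l i))))"
    using v by (intro prod.cong refl) (simp add: fact_prod)
  finally show ?thesis by simp
qed

section \<open>Integrality of the coefficients\<close>

theorem proposition5p2:
  fixes a :: "nat \<Rightarrow> real ^ 'n" and N M :: nat
    and v :: "nat \<Rightarrow> rat" and \<beta> :: "real ^ 'n"
  assumes "a ` {1..N} \<subseteq> lattice_points"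
    and "\<exists>h :: real ^ 'n \<Rightarrow> real. linear h \<and> (\<forall>i \<in> {1..N}. h (a i) = 1)"
    and "M \<le> N"
    and "\<forall>i \<in> {1..M}. v i = - 1"
    and "\<forall>i \<in> {M+1..N}. v i = 0"
    and "\<beta> = (\<Sum>i=1..N. of_rat (v i) *\<^sub>R a i)"
    and "weight_set (Delta N a)
           (face_interior (smallest_face (cone hull (Delta N a)) (- \<beta>)) \<inter> lattice_points) = real M"
  shows "\<forall>u. Phi N a v u \<in> \<int>"
proof
  fix u
  obtain h :: "real ^ 'n \<Rightarrow> real" where h: "linear h" "\<forall>i\<in>{1..N}. h (a i) = 1"
    using assms(2) by blast
  have "\<beta> = (\<Sum>i=1..M. of_rat (v i) *\<^sub>R a i) + (\<Sum>i=M+1..N. of_rat (v i) *\<^sub>R a i)"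
    using assms(3,6) sum.ub_add_nat[of 1 M _ "N - M"] by simp
  then have \<beta>: "- \<beta> = (\<Sum>i=1..M. a i)"
    using assms(4,5) by (simp add: sum_negf)
  show "Phi N a v u \<in> \<int>"
  proof (cases "\<exists>l\<in>L_of N a v. shift v l = u")
    case False
    then have none: "{l \<in> L_of N a v. shift v l = u} = {}" by blast
    show ?thesis unfolding Phi_def none by simp
  next
    case True
    then obtain l where l: "l \<in> L_of N a v" and u: "u = shift v l" by blast
    have rel: "(\<Sum>i=1..N. of_int (l i) *\<^sub>R a i) = 0"
      and ns: "i \<in> nsupp N (shift v l) \<longleftrightarrow> i \<in> nsupp N v" for i
      using l by (auto simp: L_of_def relation_lattice_def)
    \<comment> \<open>Equality of negative supports fixes the signs: from -1 the entry must stay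
      negative, from 0 it must stay nonnegative.\<close>
    have neg: "l i \<le> 0" if "i \<in> {1..M}" for i
      using ns[of i] that assms(3,4) by (auto simp: nsupp_def shift_def)
    have pos: "0 \<le> l i" if "i \<in> {M+1..N}" for i
      using ns[of i] that assms(5) by (auto simp: nsupp_def shift_def)
    have "(\<Prod>i=M+1..N. fact (nat (l i))) dvd (\<Prod>i=1..M. fact (nat (- l i)) :: nat)"
      using floor_sum_le[OF assms(1) h assms(3) _ rel neg pos] assms(7)
      by (intro prod_fact_dvd_prod_fact) (simp_all add: \<beta>)
    then obtain c where c: "(\<Prod>i=1..M. fact (nat (- l i)) :: nat)
        = (\<Prod>i=M+1..N. fact (nat (l i))) * c" by (rule dvdE)
    have nz: "of_nat (\<Prod>i=M+1..N. fact (nat (l i))) \<noteq> (0::rat)"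
      by (subst of_nat_eq_0_iff) simp
    have cancel: "x * (y * z) / y = x * z" if "y \<noteq> 0" for x y z :: rat
      using that by simp
    have "Phi N a v u = bracket_minus N v l / bracket_plus N v l"
      unfolding u by (rule Phi_shift[OF l])
    also have "bracket_minus N v l
        = (\<Prod>i=1..M. (- 1) ^ nat (- l i)) * of_nat ((\<Prod>i=M+1..N. fact (nat (l i))) * c)"
      unfolding c[symmetric] by (rule bracket_minus_eq[OF assms(3,4) neg pos])
    also have "bracket_plus N v l = of_nat (\<Prod>i=M+1..N. fact (nat (l i)))"
      by (rule bracket_plus_eq[OF assms(5) neg pos])
    also have "(\<Prod>i=1..M. (- 1) ^ nat (- l i)) * of_nat ((\<Prod>i=M+1..N. fact (nat (l i))) * c)
        / rat_of_nat (\<Prod>i=M+1..N. fact (nat (l i))) = (\<Prod>i=1..M. (- 1) ^ nat (- l i)) * of_nat c"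
      unfolding of_nat_mult by (rule cancel[OF nz])
    also have "\<dots> \<in> \<int>" by (intro Ints_mult Ints_prod Ints_power) auto
    finally show ?thesis .
  qed
qed

end
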